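(* Let $\{\theta_n\}_{n\ge0}$ be the sequence generated by the stochastic algorithm $\theta_{n+1}=\theta_n+\alpha F_n$ with deterministic $\theta_0$, and let $\varphi:\mathbb{R}_{\ge 0}\times\Theta\to\Theta$ be the flow of the mean ODE, i.e. for each $\theta\in\Theta$, $\varphi(\cdot;\theta)$ is absolutely continuous and $\varphi(t;\theta)=\theta+\int_0^tF(\varphi(\tau;\theta))\,\mathrm{d}\tau$ for all $t\ge 0$. Let $\Psi:\Theta\to\mathbb{R}_{\ge0}$ and assume that there exists an open subset $U\subseteq\Theta$ such that $\{\theta:\Psi(\theta)<\zeta\}\subseteq U$ for some $\zeta>0$, and: (A3) there exists a nonincreasing $\Delta_3:\mathbb{R}_{\ge0}\to\mathbb{R}_{\ge0}$ such that $\Delta_3(t)\downarrow0$ as $t\uparrow\infty$ and, for any $\theta\in U$ and any $t\ge0$, $\Psi(\varphi(t;\theta))\le\Delta_3(t)\Psi(\theta)$; (A4) there exists $\Delta_4:\mathbb{R}_+\times\mathbb{R}_+\to\mathbb{R}_+$, nondecreasing with respect to each argument, such that $\Delta_4(\alpha,T)\downarrow0$ as $\alpha\downarrow0$ for any fixed $T>0$ and, for any step-size $\alpha$, any $N\in\mathbb{N}_+$ and any $\theta_0\in U$, $\mathbb{E}_0[\Psi(\theta_N)]\le\Psi(\varphi(N\alpha;\theta_0))+\Delta_4(\alpha,N\alpha)\Psi(\theta_0)$. Let $\gamma_\alpha=\inf_{N\ge1}(\Delta_3(N\alpha)+\Delta_4(\alpha,N\alpha))^{1/N}$ and $\Lambda=\{\alpha>0:\gamma_\alpha<1\}$.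 Then $\Lambda$ is nonempty, and for any $\alpha\in\Lambda$ there exists at least one $N\ge1$ such that $(\Delta_3(N\alpha)+\Delta_4(\alpha,N\alpha))^{1/N}=\gamma_\alpha<1$. Let $N_\alpha$ be the minimum of such $N$. Let $\bar\gamma_\alpha=1$ if $N_\alpha=1$ and $\bar\gamma_\alpha=\max_{N\in\{1,\dots,N_\alpha-1\}}(\Delta_3(N\alpha)+\Delta_4(\alpha,N\alpha))$ otherwise. Then the following hold for any $\alpha\in\Lambda$ and any $\theta_0\in U$: 1. Let $\Omega_k=\bigcap_{i=0}^{k}[\theta_{iN_\alpha}\in U]$ be the event that $\theta_{iN_\alpha}$ stays in $U$ for $i=0,\dots,k$. Then for any $k\ge0$, $$\Pr[\Omega_k]\ge1-\frac{\Psi(\theta_0)}{\zeta}\,\frac{\gamma_\alpha^{N_\alpha}-\gamma_\alpha^{N_\alpha(k+1)}}{1-\gamma_\alpha^{N_\alpha}},$$ and $\Pr[\Omega_\infty]\ge1-\frac{\Psi(\theta_0)}{\zeta}\,\frac{\gamma_\alpha^{N_\alpha}}{1-\gamma_\alpha^{N_\alpha}}$ for $\Omega_\infty=\lim_{k\to\infty}\Omega_k$. 2. $\mathbb{E}\big[\Psi(\theta_n)\,\mathbb{I}\{\Omega_{\lfloor(n-1)/N_\alpha\rfloor}\}\big]\le(\bar\gamma_\alpha/\gamma_\alpha^{N_\alpha-1})\,\gamma_\alpha^{\,n}\,\Psi(\theta_0)$ for any $n\in\mathbb{N}_+$. 3. $\Pr[\Psi(\theta_n)<\epsilon]\ge\Pr[\Omega_{\lfloor(n-1)/N_\alpha\rfloor}]-(\Psi(\theta_0)/\epsilon)\,\gamma_\alpha^{\,n}\,(\bar\gamma_\alpha/\gamma_\alpha^{N_\alpha-1})$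 for any $n\in\mathbb{N}_+$ and $\epsilon>0$.
   Context: Notation: $\mathbb{N}_+$ is the set of positive integers; $\mathbb{R}_{\ge0}=[0,\infty)$, $\mathbb{R}_+=(0,\infty)$; $\mathbb{I}\{A\}$ is the indicator of the event $A$. Setting: $\Theta\subseteq\mathbb{R}^{D}$ for a positive integer $D$. The stochastic algorithm with constant step-size $\alpha>0$ is $\theta_{n+1}=\theta_n+\alpha F_n$, where the $F_n$ are random vectors in $\mathbb{R}^{D}$. Let $\{\mathcal{F}_n\}$ be the natural filtration associated with $\{\theta_n\}$. The dependency of $F_n$ on the past is only through $\theta_n$, and the conditional distribution of $F_n$ given $\theta_n=\theta$ does not depend on $n$ (time-homogeneity). The mean field $F(\theta)=\mathbb{E}[F_n\mid\theta_n=\theta]$ is assumed to be well defined. The associated mean ODE is $\mathrm{d}\theta/\mathrm{d}t=F(\theta)$. $\mathbb{E}_n=\mathbb{E}[\cdot\mid\mathcal{F}_n]$; in particular $\mathbb{E}_0$ is the conditional expectation given $\theta_0$. Standing assumption: for all sufficiently small $\alpha$, $\{\theta_n\}$ never leaves $\Theta$; step-sizes (in particular the elements of $\Lambda$) are understood to be in this range. Since the events $\Omega_k$ are decreasing, $\lim_{k\to\infty}\Omega_k=\bigcap_{k\ge0}\Omega_k$. *)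

theory Defs
  imports "HOL-Probability.Probability"
begin

definition natural_filtration :: "'w measure \<Rightarrow> (nat \<Rightarrow> 'w \<Rightarrow> 'b::topological_space) \<Rightarrow> nat \<Rightarrow> 'w measure" where
  "natural_filtration M X n =
     sigma (space M) {X i -` B \<inter> space M | i B. i \<le> n \<and> B \<in> sets borel}"

(* The recursion X (n + 1) = X n + alpha G n with deterministic start x, staying in Theta.
   The kernel K gives the conditional law of G n given the past sigma(X 0, ..., X n): it depends
   on the past only through X n, and it is the same for all n. *)
definition stochastic_algorithm ::
    "(real^'d) set \<Rightarrow> (real^'d \<Rightarrow> (real^'d) measure) \<Rightarrow> real \<Rightarrow> real^'d \<Rightarrow>
     'w measure \<Rightarrow> (nat \<Rightarrow> 'w \<Rightarrow> real^'d) \<Rightarrow> (nat \<Rightarrow> 'w \<Rightarrow> real^'d) \<Rightarrow> bool" where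
  "stochastic_algorithm \<Theta> K \<alpha> x M X G \<longleftrightarrow>
     prob_space M \<and>
     (\<forall>n. X n \<in> borel_measurable M) \<and>
     (\<forall>n. G n \<in> borel_measurable M) \<and>
     (\<forall>\<omega>\<in>space M. X 0 \<omega> = x) \<and>
     (\<forall>n. \<forall>\<omega>\<in>space M. X (Suc n) \<omega> = X n \<omega> + \<alpha> *\<^sub>R G n \<omega>) \<and>
     (\<forall>n. \<forall>\<omega>\<in>space M. X n \<omega> \<in> \<Theta>) \<and>
     (\<forall>n. \<forall>B\<in>sets borel. AE \<omega> in M.
        real_cond_exp M (natural_filtration M X n) (\<lambda>\<omega>'. indicator B (G n \<omega>')) \<omega>
          = measure (K (X n \<omega>)) B)"

definition absolutely_continuous_on_interval ::
    "real \<Rightarrow> real \<Rightarrow> (real \<Rightarrow> 'b::real_normed_vector) \<Rightarrow> bool" where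
  "absolutely_continuous_on_interval a b f \<longleftrightarrow>
     (\<forall>e>0. \<exists>d>0. \<forall>(m::nat) s t.
        (\<forall>i<m. a \<le> s i \<and> s i \<le> t i \<and> t i \<le> b) \<and>
        (\<forall>i<m. \<forall>j<m. i \<noteq> j \<longrightarrow> {s i<..<t i} \<inter> {s j<..<t j} = {}) \<and>
        (\<Sum>i<m. t i - s i) < d
        \<longrightarrow> (\<Sum>i<m. norm (f (t i) - f (s i))) < e)"

(* On the half-line, absolute continuity is meant on every compact interval. The integral in the
   ODE is a Lebesgue integral, whence the absolute integrability requirement. *)
definition mean_ode_flow ::
    "(real^'d) set \<Rightarrow> (real^'d \<Rightarrow> real^'d) \<Rightarrow> (real \<Rightarrow> real^'d \<Rightarrow> real^'d) \<Rightarrow> bool" where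
  "mean_ode_flow \<Theta> F \<phi> \<longleftrightarrow>
     (\<forall>x\<in>\<Theta>.
        (\<forall>t\<ge>0. \<phi> t x \<in> \<Theta>) \<and>
        (\<forall>T\<ge>0. absolutely_continuous_on_interval 0 T (\<lambda>t. \<phi> t x)) \<and>
        (\<forall>t\<ge>0. (\<lambda>\<tau>. F (\<phi> \<tau> x)) absolutely_integrable_on {0..t} \<and>
                \<phi> t x = x + integral {0..t} (\<lambda>\<tau>. F (\<phi> \<tau> x))))"

definition contraction :: "(real \<Rightarrow> real) \<Rightarrow> (real \<Rightarrow> real \<Rightarrow> real) \<Rightarrow> real \<Rightarrow> nat \<Rightarrow> real" where
  "contraction \<Delta>\<^sub>3 \<Delta>\<^sub>4 \<alpha> N = \<Delta>\<^sub>3 (real N * \<alpha>) + \<Delta>\<^sub>4 \<alpha> (real N * \<alpha>)"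

definition rate :: "(real \<Rightarrow> real) \<Rightarrow> (real \<Rightarrow> real \<Rightarrow> real) \<Rightarrow> real \<Rightarrow> real" where
  "rate \<Delta>\<^sub>3 \<Delta>\<^sub>4 \<alpha> = (INF N\<in>{1..}. contraction \<Delta>\<^sub>3 \<Delta>\<^sub>4 \<alpha> N powr (1 / real N))"

(* S is the range of step-sizes for which the algorithm stays in its state space. *)
definition good_steps :: "real set \<Rightarrow> (real \<Rightarrow> real) \<Rightarrow> (real \<Rightarrow> real \<Rightarrow> real) \<Rightarrow> real set" where
  "good_steps S \<Delta>\<^sub>3 \<Delta>\<^sub>4 = {\<alpha>\<in>S. 0 < \<alpha> \<and> rate \<Delta>\<^sub>3 \<Delta>\<^sub>4 \<alpha> < 1}"

definition block_length :: "(real \<Rightarrow> real) \<Rightarrow> (real \<Rightarrow> real \<Rightarrow> real) \<Rightarrow> real \<Rightarrow> nat" where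
  "block_length \<Delta>\<^sub>3 \<Delta>\<^sub>4 \<alpha> =
     (LEAST N. 1 \<le> N \<and> contraction \<Delta>\<^sub>3 \<Delta>\<^sub>4 \<alpha> N powr (1 / real N) = rate \<Delta>\<^sub>3 \<Delta>\<^sub>4 \<alpha>)"

definition block_max :: "(real \<Rightarrow> real) \<Rightarrow> (real \<Rightarrow> real \<Rightarrow> real) \<Rightarrow> real \<Rightarrow> real" where
  "block_max \<Delta>\<^sub>3 \<Delta>\<^sub>4 \<alpha> =
     (if block_length \<Delta>\<^sub>3 \<Delta>\<^sub>4 \<alpha> = 1 then 1
      else Max (contraction \<Delta>\<^sub>3 \<Delta>\<^sub>4 \<alpha> ` {1..block_length \<Delta>\<^sub>3 \<Delta>\<^sub>4 \<alpha> - 1}))"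

definition stay_event ::
    "'w measure \<Rightarrow> (nat \<Rightarrow> 'w \<Rightarrow> 'b) \<Rightarrow> 'b set \<Rightarrow> nat \<Rightarrow> nat \<Rightarrow> 'w set" where
  "stay_event M X U N k = {\<omega>\<in>space M. \<forall>i\<le>k. X (i * N) \<omega> \<in> U}"

end

theory Submission
  imports Defs
begin

text \<open>
The function \<open>\<Psi>\<close> is a Lyapunov function that contracts in expectation over blocks of steps. Combining the
decay of \<open>\<Psi>\<close> along the flow with the bound on the deviation of the algorithm from the flow gives, for
every starting point in \<open>U\<close> and every \<open>n \<ge> 1\<close>, that the expectation of \<open>\<Psi>\<close> after \<open>n\<close> steps is at most
\<open>c n\<close> times its initial value, where \<open>c n\<close> abbreviates \<open>contraction \<Delta>\<^sub>3 \<Delta>\<^sub>4 \<alpha> n\<close>. Small steps and a long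
time horizon make some \<open>c n\<close> smaller than \<open>1\<close> (\<open>good_steps_nonempty\<close>). The block length \<open>N\<close> minimises
the contraction per step; the minimum exists because the factors \<open>c n\<close> are bounded away from \<open>0\<close>, so
that the limit inferior of their \<open>n\<close>-th roots is at least \<open>1\<close>, above \<open>\<gamma>\<close> (\<open>roots_attain_infimum\<close>). Thus \<open>c N = \<gamma> ^ N\<close>.

The drift bound concerns a deterministic starting point. To restart it at the end of each block
one needs the Markov property (\<open>markov_property\<close>): the expected future after time \<open>m\<close>, on an event
of the past, is that of the process started at the current state. It follows from the conditional law of
the increments: the joint law of the current state and the next increment is determined on rectangles
and hence everywhere, the law of one step is a kernel that does not depend on time, and steps compose.

On the event that the ends of the first \<open>k\<close> blocks lie in \<open>U\<close>, the contraction can be applied once more,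
so that the expectation of \<open>\<Psi>\<close> on this event decays like \<open>\<gamma> ^ (k * N)\<close> (\<open>decay_at_blocks\<close>), with one
further factor for an incomplete last block (\<open>decay_within_block\<close>). Leaving \<open>U\<close> at the end of a block
requires \<open>\<Psi> \<ge> \<zeta>\<close>, so Markov's inequality bounds the probability of a first exit in block \<open>k + 1\<close> by
\<open>\<gamma> ^ (N * (k + 1)) * \<Psi> \<theta>\<^sub>0 / \<zeta>\<close>. Summing this geometric series bounds the probability of ever leaving, and
the same inequality with \<open>\<epsilon>\<close> in place of \<open>\<zeta>\<close> gives the tail bound for \<open>\<Psi>\<close> at a single time.
\<close>

section \<open>Contraction factors and block lengths\<close>

text \<open>Since \<open>\<delta> powr (1 / n)\<close> tends to \<open>1\<close>, all but finitely many of the roots lie above the midpoint between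
\<open>\<gamma>\<close> and \<open>1\<close>, so the infimum is one over a finite set.\<close>

lemma roots_attain_infimum:
  fixes a :: "nat \<Rightarrow> real"
  defines "\<gamma> \<equiv> (INF n\<in>{1..}. a n powr (1 / real n))"
  assumes \<delta>: "0 < \<delta>" "\<And>n. 1 \<le> n \<Longrightarrow> \<delta> \<le> a n" and \<gamma>: "\<gamma> < 1"
  shows "\<exists>n\<ge>1. a n powr (1 / real n) = \<gamma>"
proof -
  define r where "r n = a n powr (1 / real n)" for n
  have bdd: "bdd_below (r ` {1..})" by (intro bdd_belowI[of _ 0]) (auto simp: r_def)
  have "(\<lambda>n. \<delta> powr (1 / real n)) \<longlonglongrightarrow> \<delta> powr 0"
    using \<delta>(1) by (intro tendsto_powr tendsto_const lim_1_over_n) auto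
  then have "\<forall>\<^sub>F n in sequentially. (1 + \<gamma>) / 2 < \<delta> powr (1 / real n)"
    using \<gamma> \<delta>(1) by (intro order_tendstoD(1)) auto
  then obtain n0 where n0: "\<And>n. n0 \<le> n \<Longrightarrow> (1 + \<gamma>) / 2 < \<delta> powr (1 / real n)"
    by (auto simp: eventually_sequentially)
  have tail: "(1 + \<gamma>) / 2 < r n" if "n0 \<le> n" "1 \<le> n" for n
    using n0[OF that(1)] \<delta> that(2) unfolding r_def
    by (meson less_le_trans less_imp_le powr_mono2 of_nat_0_le_iff divide_nonneg_nonneg zero_le_one)
  have "\<gamma> < (1 + \<gamma>) / 2" using \<gamma> by simp
  then obtain n1 where n1: "1 \<le> n1" "r n1 < (1 + \<gamma>) / 2"
    unfolding \<gamma>_def r_def[symmetric] by (subst (asm) cINF_less_iff[OF _ bdd]) auto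
  then have "n1 < n0" using tail[of n1] by force
  with n1(1) have "r ` {1..<n0} \<noteq> {}" by auto
  then have "Min (r ` {1..<n0}) \<in> r ` {1..<n0}" by (intro Min_in) auto
  then obtain n where n: "1 \<le> n" "r n = Min (r ` {1..<n0})" by auto
  have "r n \<le> r k" if "1 \<le> k" for k
  proof (cases "k < n0")
    case True
    then show ?thesis using that by (simp add: n(2))
  next
    case False
    have "r n \<le> r n1" using n1(1) \<open>n1 < n0\<close> by (simp add: n(2))
    also have "\<dots> \<le> r k" using n1(2) tail[of k] False that by simp
    finally show ?thesis .
  qed
  then have "r n \<le> \<gamma>" unfolding \<gamma>_def r_def[symmetric] by (intro cINF_greatest) auto
  moreover have "\<gamma> \<le> r n" unfolding \<gamma>_def r_def[symmetric] using n(1) by (intro cINF_lower bdd) auto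
  ultimately show ?thesis using n(1) by (auto simp: r_def intro!: exI[of _ n])
qed

lemma rate_le:
  assumes "1 \<le> n"
  shows "rate \<Delta>\<^sub>3 \<Delta>\<^sub>4 \<alpha> \<le> contraction \<Delta>\<^sub>3 \<Delta>\<^sub>4 \<alpha> n powr (1 / real n)"
  unfolding rate_def by (rule cINF_lower) (use assms in \<open>auto intro!: bdd_belowI[of _ 0]\<close>)

lemma good_steps_nonempty:
  fixes \<Delta>\<^sub>3 :: "real \<Rightarrow> real" and \<Delta>\<^sub>4 :: "real \<Rightarrow> real \<Rightarrow> real"
  assumes S: "S \<subseteq> {0<..}" "\<forall>\<^sub>F \<alpha> in at_right 0. \<alpha> \<in> S"
    and \<Delta>\<^sub>3: "\<And>t. 0 \<le> t \<Longrightarrow> 0 \<le> \<Delta>\<^sub>3 t" "(\<Delta>\<^sub>3 \<longlongrightarrow> 0) at_top"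
    and \<Delta>\<^sub>4: "\<And>\<alpha> T. 0 < \<alpha> \<Longrightarrow> 0 < T \<Longrightarrow> 0 < \<Delta>\<^sub>4 \<alpha> T" "\<And>\<alpha>. 0 < \<alpha> \<Longrightarrow> mono_on {0<..} (\<Delta>\<^sub>4 \<alpha>)"
      "\<And>T. 0 < T \<Longrightarrow> ((\<lambda>\<alpha>. \<Delta>\<^sub>4 \<alpha> T) \<longlongrightarrow> 0) (at_right 0)"
  shows "good_steps S \<Delta>\<^sub>3 \<Delta>\<^sub>4 \<noteq> {}"
proof -
  \<comment> \<open>A time \<open>T\<close> after which the flow contracts by one half, and then a
    step-size so small that the error accumulated over \<open>T + 1\<close> is below one half. The
    extra unit of time makes room for a multiple of \<open>\<alpha>\<close>.\<close>
  have "\<forall>\<^sub>F t in at_top. \<Delta>\<^sub>3 t < 1/2"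
    by (rule order_tendstoD(2)[OF \<Delta>\<^sub>3(2)]) simp
  then obtain T0 where T0: "\<And>t. T0 \<le> t \<Longrightarrow> \<Delta>\<^sub>3 t < 1/2" by (auto simp: eventually_at_top_linorder)
  define T where "T = max T0 1"
  have T: "0 < T" "T0 \<le> T" by (auto simp: T_def)
  have "\<forall>\<^sub>F \<alpha> in at_right 0. \<Delta>\<^sub>4 \<alpha> (T + 1) < 1/2"
    using T by (intro order_tendstoD(2)[OF \<Delta>\<^sub>4(3)]) auto
  moreover have "\<forall>\<^sub>F \<alpha> in at_right 0. \<alpha> < (1::real)"
    by (rule eventually_at_right_less[THEN eventually_mono] order_tendstoD(2)[OF tendsto_ident_at])+ simp
  ultimately have "\<forall>\<^sub>F \<alpha> in at_right 0. \<alpha> \<in> S \<and> \<Delta>\<^sub>4 \<alpha> (T + 1) < 1/2 \<and> \<alpha> < 1"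
    using S(2) by eventually_elim simp
  then obtain \<alpha> where \<alpha>: "\<alpha> \<in> S" "\<Delta>\<^sub>4 \<alpha> (T + 1) < 1/2" "\<alpha> < 1"
    using eventually_happens[of _ "at_right (0::real)"] by (auto simp: trivial_limit_at_right_real)
  then have pos: "0 < \<alpha>" using S(1) by auto
  define n where "n = nat \<lceil>T / \<alpha>\<rceil>"
  have "0 < T / \<alpha>" using T pos by simp
  then have n: "T / \<alpha> \<le> real n" "real n < T / \<alpha> + 1" unfolding n_def by linarith+
  then have "1 \<le> n" using \<open>0 < T / \<alpha>\<close> by linarith
  have lower: "T \<le> real n * \<alpha>" using n(1) pos by (simp add: field_simps)
  have upper: "real n * \<alpha> \<le> T + 1"
    using n(2) pos \<alpha>(3) by (simp add: field_simps)
  have "\<Delta>\<^sub>4 \<alpha> (real n * \<alpha>) \<le> \<Delta>\<^sub>4 \<alpha> (T + 1)"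
    using lower upper T by (intro mono_onD[OF \<Delta>\<^sub>4(2)[OF pos]]) auto
  moreover have "\<Delta>\<^sub>3 (real n * \<alpha>) < 1/2" using lower T by (intro T0) auto
  ultimately have "contraction \<Delta>\<^sub>3 \<Delta>\<^sub>4 \<alpha> n < 1" using \<alpha>(2) by (simp add: contraction_def)
  moreover have "0 \<le> contraction \<Delta>\<^sub>3 \<Delta>\<^sub>4 \<alpha> n"
    using \<Delta>\<^sub>3(1)[of "real n * \<alpha>"] \<Delta>\<^sub>4(1)[of \<alpha> "real n * \<alpha>"] lower T pos by (simp add: contraction_def)
  ultimately have "contraction \<Delta>\<^sub>3 \<Delta>\<^sub>4 \<alpha> n powr (1 / real n) < 1 powr (1 / real n)"
    using \<open>1 \<le> n\<close> by (intro powr_less_mono2) auto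
  then have "rate \<Delta>\<^sub>3 \<Delta>\<^sub>4 \<alpha> < 1" using rate_le[OF \<open>1 \<le> n\<close>, of \<Delta>\<^sub>3 \<Delta>\<^sub>4 \<alpha>] by simp
  with \<alpha>(1) pos show ?thesis by (auto simp: good_steps_def)
qed

text \<open>Monotonicity in \<open>T\<close> bounds all factors below by \<open>\<Delta>\<^sub>4 \<alpha> \<alpha>\<close>, which is positive; this is what makes the
infimum attained. The last claim is the estimate for a block that is cut off after \<open>r\<close> steps. There
\<open>\<gamma>'\<close> dominates the factors inside the block, while \<open>\<gamma> ^ j \<le> c j\<close> for every \<open>j \<ge> 1\<close> gives
\<open>\<gamma> ^ (N - 1) \<le> \<gamma>'\<close>, which covers the complete block \<open>r = N\<close>.\<close>

lemma
  fixes \<Delta>\<^sub>3 :: "real \<Rightarrow> real" and \<Delta>\<^sub>4 :: "real \<Rightarrow> real \<Rightarrow> real"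
  assumes \<alpha>: "0 < \<alpha>" "rate \<Delta>\<^sub>3 \<Delta>\<^sub>4 \<alpha> < 1"
    and \<Delta>\<^sub>3: "\<And>t. 0 \<le> t \<Longrightarrow> 0 \<le> \<Delta>\<^sub>3 t"
    and \<Delta>\<^sub>4: "\<And>\<alpha> T. 0 < \<alpha> \<Longrightarrow> 0 < T \<Longrightarrow> 0 < \<Delta>\<^sub>4 \<alpha> T" "\<And>\<alpha>. 0 < \<alpha> \<Longrightarrow> mono_on {0<..} (\<Delta>\<^sub>4 \<alpha>)"
  defines "\<gamma> \<equiv> rate \<Delta>\<^sub>3 \<Delta>\<^sub>4 \<alpha>" and "N \<equiv> block_length \<Delta>\<^sub>3 \<Delta>\<^sub>4 \<alpha>"
    and "c \<equiv> contraction \<Delta>\<^sub>3 \<Delta>\<^sub>4 \<alpha>" and "\<gamma>' \<equiv> block_max \<Delta>\<^sub>3 \<Delta>\<^sub>4 \<alpha>"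
  shows contraction_pos: "1 \<le> n \<Longrightarrow> 0 < c n"
    and block_length_ge_1: "1 \<le> N"
    and block_length_attains: "c N powr (1 / real N) = \<gamma>"
    and rate_pos: "0 < \<gamma>"
    and contraction_block: "c N = \<gamma> ^ N"
    and contraction_within_block: "1 \<le> r \<Longrightarrow> r \<le> N \<Longrightarrow> c r \<le> \<gamma>' / \<gamma> ^ (N - 1) * \<gamma> ^ r"
proof -
  have ge: "\<Delta>\<^sub>4 \<alpha> \<alpha> \<le> c n" if "1 \<le> n" for n
  proof -
    have le: "\<alpha> \<le> real n * \<alpha>" using that \<alpha>(1) by simp
    then have "\<Delta>\<^sub>4 \<alpha> \<alpha> \<le> \<Delta>\<^sub>4 \<alpha> (real n * \<alpha>)"
      using \<alpha>(1) by (intro mono_onD[OF \<Delta>\<^sub>4(2)]) auto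
    then show ?thesis using \<Delta>\<^sub>3[of "real n * \<alpha>"] \<alpha>(1) by (simp add: c_def contraction_def)
  qed
  have \<delta>: "0 < \<Delta>\<^sub>4 \<alpha> \<alpha>" using \<Delta>\<^sub>4(1) \<alpha>(1) by simp
  show c_pos: "0 < c n" if "1 \<le> n" for n using ge[OF that] \<delta> by simp
  have "\<exists>n. 1 \<le> n \<and> c n powr (1 / real n) = \<gamma>"
    using roots_attain_infimum[of "\<Delta>\<^sub>4 \<alpha> \<alpha>" c, OF \<delta> ge] \<alpha>(2) by (auto simp: \<gamma>_def rate_def c_def)
  from LeastI_ex[OF this]
  show N: "1 \<le> N" and att: "c N powr (1 / real N) = \<gamma>"
    by (auto simp: N_def block_length_def c_def \<gamma>_def)
  show \<gamma>_pos: "0 < \<gamma>" using att c_pos[OF N] by (metis less_numeral_extra(3) powr_gt_zero)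
  have root_pow: "(c n powr (1 / real n)) ^ n = c n" if "1 \<le> n" for n
    using that c_pos[OF that] by (simp add: powr_powr flip: powr_realpow)
  show cN: "c N = \<gamma> ^ N" using root_pow[OF N] att by simp
  show "c r \<le> \<gamma>' / \<gamma> ^ (N - 1) * \<gamma> ^ r" if r: "1 \<le> r" "r \<le> N"
  proof -
    have max: "c j \<le> \<gamma>'" if "1 \<le> j" "j < N" for j
      using that unfolding \<gamma>'_def block_max_def c_def N_def by (auto intro!: Max_ge)
    have pow_le: "\<gamma> ^ j \<le> c j" if "1 \<le> j" for j
      using power_mono[OF rate_le[OF that, of \<Delta>\<^sub>3 \<Delta>\<^sub>4 \<alpha>], of j] \<gamma>_pos root_pow[OF that]
      by (simp add: \<gamma>_def c_def)
    have g': "\<gamma> ^ (N - 1) \<le> \<gamma>'"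
    proof (cases "N = 1")
      case True
      then show ?thesis by (simp add: \<gamma>'_def block_max_def N_def[symmetric])
    next
      case False
      with N have "1 \<le> N - 1" "N - 1 < N" by auto
      then show ?thesis using pow_le[of "N - 1"] max[of "N - 1"] by linarith
    qed
    show ?thesis
    proof (cases "r = N")
      case True
      have "c r = \<gamma> ^ (N - 1) * \<gamma>" using True cN N by (cases N) auto
      also have "\<dots> \<le> \<gamma>' * \<gamma>" using g' \<gamma>_pos by simp
      also have "\<dots> = \<gamma>' / \<gamma> ^ (N - 1) * \<gamma> ^ r" using True N \<gamma>_pos by (cases N) (auto simp: field_simps)
      finally show ?thesis .
    next
      case False
      have "\<gamma> ^ (N - 1) \<le> \<gamma> ^ r" using False r \<gamma>_pos \<alpha>(2) by (intro power_decreasing) (auto simp: \<gamma>_def)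
      have "0 < \<gamma>'" using less_le_trans[OF zero_less_power[OF \<gamma>_pos] g'] .
      have "c r \<le> \<gamma>'" using max r False by simp
      also have "\<dots> \<le> \<gamma>' * (\<gamma> ^ r / \<gamma> ^ (N - 1))"
        using \<open>0 < \<gamma>'\<close> \<gamma>_pos \<open>\<gamma> ^ (N - 1) \<le> \<gamma> ^ r\<close> by (simp add: pos_le_divide_eq)
      finally show ?thesis by (simp add: field_simps)
    qed
  qed
qed

section \<open>The natural filtration\<close>

lemma space_natural_filtration [simp]: "space (natural_filtration M X n) = space M"
  by (simp add: natural_filtration_def space_measure_of_conv)

lemma sets_natural_filtration:
  "sets (natural_filtration M X n) =
     sigma_sets (space M) {X i -` B \<inter> space M | i B. i \<le> n \<and> B \<in> sets borel}"
  unfolding natural_filtration_def by (rule sets_measure_of) auto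

lemma subalgebra_natural_filtration:
  assumes "\<And>i. X i \<in> borel_measurable M"
  shows "subalgebra M (natural_filtration M X n)"
  unfolding subalgebra_def sets_natural_filtration
  using assms by (auto intro!: sets.sigma_sets_subset measurable_sets)

lemma natural_filtration_mono:
  assumes "m \<le> n"
  shows "sets (natural_filtration M X m) \<subseteq> sets (natural_filtration M X n)"
  unfolding sets_natural_filtration using assms by (intro sigma_sets_mono') force

lemma measurable_natural_filtration:
  assumes "i \<le> n"
  shows "X i \<in> borel_measurable (natural_filtration M X n)"
  using assms by (intro measurableI) (auto simp: sets_natural_filtration intro!: sigma_sets.Basic)

section \<open>The Markov property of the algorithm\<close>

text \<open>The whole family of processes, one for each starting point, shares the kernel \<open>K\<close>. This is what makes
the future after time \<open>m\<close> comparable with a fresh process started at \<open>X x m\<close>.\<close>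

locale algorithm_family =
  fixes \<Theta> :: "(real^'d) set"
    and K :: "real^'d \<Rightarrow> (real^'d) measure"
    and \<alpha> :: real
    and M :: "real^'d \<Rightarrow> 'w measure"
    and X G :: "real^'d \<Rightarrow> nat \<Rightarrow> 'w \<Rightarrow> real^'d"
  assumes kernel: "K \<in> restrict_space borel \<Theta> \<rightarrow>\<^sub>M prob_algebra borel"
    and algorithm: "\<And>x. x \<in> \<Theta> \<Longrightarrow> stochastic_algorithm \<Theta> K \<alpha> x (M x) (X x) (G x)"
begin

abbreviation states :: "(real^'d) measure" where
  "states \<equiv> restrict_space borel \<Theta>"

abbreviation past :: "real^'d \<Rightarrow> nat \<Rightarrow> 'w measure" where
  "past x \<equiv> natural_filtration (M x) (X x)"

text \<open>The transition law is taken as the law of the first step on the trace \<open>\<sigma>\<close>-algebra of \<open>\<Theta>\<close>, not as the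
image of \<open>K y\<close> under \<open>\<lambda>g. y + \<alpha> *\<^sub>R g\<close>. The set \<open>\<Theta>\<close> may fail to be Borel; the image measure then
lives on the whole space and cannot be restricted to \<open>\<Theta>\<close>, whereas the process itself never leaves
\<open>\<Theta>\<close>.\<close>

definition trans_kernel :: "real^'d \<Rightarrow> (real^'d) measure" where
  "trans_kernel y = distr (M y) states (X y 1)"

lemma space_states [simp]: "space states = \<Theta>"
  by (simp add: space_restrict_space)

lemma
  assumes "x \<in> \<Theta>"
  shows prob_space_M: "prob_space (M x)"
    and measurable_X: "X x n \<in> borel_measurable (M x)"
    and measurable_G: "G x n \<in> borel_measurable (M x)"
    and X_0: "\<omega> \<in> space (M x) \<Longrightarrow> X x 0 \<omega> = x"
    and X_Suc: "\<omega> \<in> space (M x) \<Longrightarrow> X x (Suc n) \<omega> = X x n \<omega> + \<alpha> *\<^sub>R G x n \<omega>"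
    and X_in_states: "\<omega> \<in> space (M x) \<Longrightarrow> X x n \<omega> \<in> \<Theta>"
    and cond_law: "B \<in> sets borel \<Longrightarrow> AE \<omega> in M x.
        real_cond_exp (M x) (past x n) (\<lambda>\<omega>'. indicator B (G x n \<omega>')) \<omega> = measure (K (X x n \<omega>)) B"
  using algorithm[OF assms] unfolding stochastic_algorithm_def by blast+

lemma measurable_X_states: "x \<in> \<Theta> \<Longrightarrow> X x n \<in> M x \<rightarrow>\<^sub>M states"
  by (intro measurable_restrict_space2) (auto simp: measurable_X X_in_states)

lemma subalgebra_past: "x \<in> \<Theta> \<Longrightarrow> subalgebra (M x) (past x n)"
  by (intro subalgebra_natural_filtration measurable_X)

lemma past_sets: "x \<in> \<Theta> \<Longrightarrow> A \<in> sets (past x n) \<Longrightarrow> A \<in> sets (M x)"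
  using subalgebra_past[of x n] by (auto simp: subalgebra_def)

lemma kernel_subprob: "K \<in> states \<rightarrow>\<^sub>M subprob_algebra borel"
  by (intro measurable_prob_algebraD kernel)

lemma kernel_props:
  assumes "y \<in> \<Theta>" shows "prob_space (K y)" "sets (K y) = sets borel" "space (K y) = UNIV"
proof -
  show 1: "prob_space (K y)" "sets (K y) = sets borel"
    using measurable_space[OF kernel, of y] assms by (auto simp: space_prob_algebra)
  show "space (K y) = UNIV" using sets_eq_imp_space_eq[OF 1(2)] by simp
qed

text \<open>The defining property of conditional expectation, integrated over an event \<open>A\<close> of the past.\<close>

lemma noise_law:
  assumes x: "x \<in> \<Theta>" and A: "A \<in> sets (past x m)" and D: "D \<in> sets borel"
  shows "emeasure (M x) {\<omega> \<in> A. G x m \<omega> \<in> D} =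
           (\<integral>\<^sup>+\<omega>. indicator A \<omega> * emeasure (K (X x m \<omega>)) D \<partial>M x)"
proof -
  interpret P: prob_space "M x" by (rule prob_space_M[OF x])
  interpret S: finite_measure_subalgebra "M x" "past x m"
    by standard (rule subalgebra_past[OF x])
  note [measurable] = measurable_G[OF x] measurable_X_states[OF x] kernel_subprob D
    and AM [measurable] = past_sets[OF x A]
  have A_sub: "A \<subseteq> space (M x)" by (rule sets.sets_into_space[OF AM])
  have prob_K: "emeasure (K (X x m \<omega>)) D = ennreal (measure (K (X x m \<omega>)) D)"
      "measure (K (X x m \<omega>)) D \<le> 1" if "\<omega> \<in> space (M x)" for \<omega>
    using kernel_props(1)[OF X_in_states[OF x that]]
    by (auto simp: finite_measure.emeasure_eq_measure prob_space.prob_le_1 prob_space.finite_measure)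
  have meas_K [measurable]: "(\<lambda>\<omega>. measure (K (X x m \<omega>)) D) \<in> borel_measurable (M x)"
    by measurable
  have int_G: "integrable (M x) (\<lambda>\<omega>. indicator D (G x m \<omega>) :: real)"
    by (rule P.integrable_const_bound[of _ 1]) auto
  have int_K: "integrable (M x) (\<lambda>\<omega>. indicator A \<omega> * measure (K (X x m \<omega>)) D)"
    by (rule P.integrable_const_bound[of _ 1])
       (auto simp: prob_K(2) indicator_def split: if_splits)
  have "P.prob {\<omega> \<in> A. G x m \<omega> \<in> D} = (\<integral>\<omega>. indicator {\<omega> \<in> A. G x m \<omega> \<in> D} \<omega> \<partial>M x)"
    using A_sub by (auto intro!: arg_cong[where f = P.prob])
  also have "\<dots> = (\<integral>\<omega>\<in>A. indicator D (G x m \<omega>) \<partial>M x)"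
    unfolding set_lebesgue_integral_def by (intro Bochner_Integration.integral_cong)
      (auto simp: indicator_def)
  also have "\<dots> = (\<integral>\<omega>\<in>A. real_cond_exp (M x) (past x m) (\<lambda>\<omega>'. indicator D (G x m \<omega>')) \<omega> \<partial>M x)"
    by (rule S.real_cond_exp_intA[OF int_G A])
  also have "\<dots> = (\<integral>\<omega>. indicator A \<omega> * measure (K (X x m \<omega>)) D \<partial>M x)"
    unfolding set_lebesgue_integral_def
    by (intro integral_cong_AE) (use cond_law[OF x D, of m] in auto)
  finally have "emeasure (M x) {\<omega> \<in> A. G x m \<omega> \<in> D} =
      ennreal (\<integral>\<omega>. indicator A \<omega> * measure (K (X x m \<omega>)) D \<partial>M x)"
    by (simp add: P.emeasure_eq_measure)
  also have "\<dots> = (\<integral>\<^sup>+\<omega>. ennreal (indicator A \<omega> * measure (K (X x m \<omega>)) D) \<partial>M x)"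
    by (rule nn_integral_eq_integral[symmetric, OF int_K]) auto
  also have "\<dots> = (\<integral>\<^sup>+\<omega>. indicator A \<omega> * emeasure (K (X x m \<omega>)) D \<partial>M x)"
    by (intro nn_integral_cong) (auto simp: prob_K(1) indicator_def)
  finally show ?thesis .
qed


text \<open>Events of the past and the state \<open>X x m\<close> combine into events of the past, so \<open>noise_law\<close> settles
rectangles \<open>a \<times> b\<close>. Both sides are finite measures in \<open>C\<close>, the right-hand one being a mixture of the
laws \<open>K y\<close> attached to the state \<open>y\<close>, and the rectangles form an intersection-stable generator.\<close>

lemma joint_law:
  assumes x: "x \<in> \<Theta>" and A: "A \<in> sets (past x m)" and C: "C \<in> sets (states \<Otimes>\<^sub>M borel)"
  shows "emeasure (M x) {\<omega> \<in> A. (X x m \<omega>, G x m \<omega>) \<in> C} =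
           (\<integral>\<^sup>+\<omega>. indicator A \<omega> * emeasure (K (X x m \<omega>)) (Pair (X x m \<omega>) -` C) \<partial>M x)"
    (is "?L C = ?R C")
proof -
  interpret P: prob_space "M x" by (rule prob_space_M[OF x])
  note [measurable] = measurable_G[OF x] measurable_X_states[OF x] kernel_subprob
    and AM [measurable] = past_sets[OF x A]
  have A_sub: "A \<subseteq> space (M x)" by (rule sets.sets_into_space[OF AM])
  \<comment> \<open>\<open>N\<close> is the law of the state on \<open>A\<close>; \<open>J y\<close>
    is \<open>K y\<close> transported to the fibre over \<open>y\<close>, so that \<open>N \<bind>
    J\<close> is the right-hand side.\<close>
  define N where "N = distr (density (M x) (indicator A)) states (X x m)"
  define J where "J y = distr (K y) (states \<Otimes>\<^sub>M borel) (Pair y)" for y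
  have J [measurable]: "J \<in> states \<rightarrow>\<^sub>M subprob_algebra (states \<Otimes>\<^sub>M borel)"
    unfolding J_def by (rule measurable_distr2[OF _ kernel_subprob]) simp
  have N_J: "emeasure (N \<bind> J) C = ?R C" if C: "C \<in> sets (states \<Otimes>\<^sub>M borel)" for C
  proof -
    note [measurable] = C
    have Kx: "emeasure (J y) C = emeasure (K y) (Pair y -` C)" if "y \<in> \<Theta>" for y
    proof -
      have "Pair y \<in> K y \<rightarrow>\<^sub>M states \<Otimes>\<^sub>M borel"
        using that kernel_props[OF that] by (simp cong: measurable_cong_sets)
      then show ?thesis by (simp add: J_def emeasure_distr kernel_props[OF that])
    qed
    have "emeasure (N \<bind> J) C = (\<integral>\<^sup>+y. emeasure (J y) C \<partial>N)"
      by (rule emeasure_bind[where N = "states \<Otimes>\<^sub>M borel"]) (use x C in \<open>auto simp: N_def\<close>)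
    also have "\<dots> = (\<integral>\<^sup>+\<omega>. indicator A \<omega> * emeasure (J (X x m \<omega>)) C \<partial>M x)"
      unfolding N_def by (simp add: nn_integral_distr nn_integral_density)
    also have "\<dots> = ?R C"
      by (intro nn_integral_cong) (simp add: Kx X_in_states[OF x])
    finally show ?thesis .
  qed
  define L where "L = distr (density (M x) (indicator A)) (states \<Otimes>\<^sub>M borel) (\<lambda>\<omega>. (X x m \<omega>, G x m \<omega>))"
  have L: "emeasure L C = ?L C" if C: "C \<in> sets (states \<Otimes>\<^sub>M borel)" for C
  proof -
    have "emeasure L C = emeasure (M x) (A \<inter> ((\<lambda>\<omega>. (X x m \<omega>, G x m \<omega>)) -` C \<inter> space (M x)))"
      unfolding L_def using C by (simp add: emeasure_distr emeasure_density nn_integral_indicator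
          flip: indicator_inter_arith)
    also have "A \<inter> ((\<lambda>\<omega>. (X x m \<omega>, G x m \<omega>)) -` C \<inter> space (M x)) = {\<omega> \<in> A. (X x m \<omega>, G x m \<omega>) \<in> C}"
      using A_sub by auto
    finally show ?thesis .
  qed
  let ?E = "{a \<times> b | a b. a \<in> sets states \<and> b \<in> sets (borel :: (real^'d) measure)}"
  have "L = N \<bind> J"
  proof (rule measure_eqI_generator_eq[where E = ?E and \<Omega> = "\<Theta> \<times> UNIV" and A = "\<lambda>_. \<Theta> \<times> UNIV"])
    show "Int_stable ?E" by (rule Int_stable_pair_measure_generator)
    show "?E \<subseteq> Pow (\<Theta> \<times> UNIV)" using sets.sets_into_space[of _ states] by auto
    show "sets L = sigma_sets (\<Theta> \<times> UNIV) ?E"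
      by (simp add: L_def sets_pair_measure)
    show "sets (N \<bind> J) = sigma_sets (\<Theta> \<times> UNIV) ?E"
      using x by (subst sets_bind[where N = "states \<Otimes>\<^sub>M borel"])
        (auto simp: N_def J_def sets_pair_measure)
    show "range (\<lambda>_::nat. \<Theta> \<times> UNIV) \<subseteq> ?E"
      using sets.top[of states] sets.top[of "borel :: (real^'d) measure"] unfolding space_states space_borel by blast
    show "emeasure L (\<Theta> \<times> UNIV) \<noteq> \<infinity>"
      using sets.top[of "states \<Otimes>\<^sub>M (borel :: (real^'d) measure)"]
      by (subst L) (auto simp: space_pair_measure P.emeasure_eq_measure)
  next
    fix Z assume "Z \<in> ?E"
    then obtain a b where Z: "Z = a \<times> b" and a: "a \<in> sets states" and b [measurable]: "b \<in> sets borel"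
      by auto
    obtain B where B: "B \<in> sets borel" "a = \<Theta> \<inter> B"
      using a by (auto simp: sets_restrict_space)
    have A': "A \<inter> (X x m -` B \<inter> space (M x)) \<in> sets (past x m)"
      using measurable_sets[OF measurable_natural_filtration[OF order_refl] B(1), of "X x" m "M x"]
      by (intro sets.Int[OF A]) simp
    have "emeasure L Z = emeasure (M x) {\<omega> \<in> A \<inter> (X x m -` B \<inter> space (M x)). G x m \<omega> \<in> b}"
      using a A_sub X_in_states[OF x] by (subst L) (auto simp: Z B intro!: arg_cong[where f = "emeasure (M x)"])
    also have "\<dots> = (\<integral>\<^sup>+\<omega>. indicator (A \<inter> (X x m -` B \<inter> space (M x))) \<omega> * emeasure (K (X x m \<omega>)) b \<partial>M x)"
      by (rule noise_law[OF x A' b])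
    also have "\<dots> = ?R Z"
      using X_in_states[OF x] by (intro nn_integral_cong) (auto simp: Z B indicator_def)
    also have "\<dots> = emeasure (N \<bind> J) Z"
      by (rule N_J[symmetric]) (use a in \<open>auto simp: Z\<close>)
    finally show "emeasure L Z = emeasure (N \<bind> J) Z" .
  qed auto
  then show ?thesis using L[OF C] N_J[OF C] by simp
qed

lemma step_measurable: "(\<lambda>z. fst z + \<alpha> *\<^sub>R snd z) \<in> states \<Otimes>\<^sub>M borel \<rightarrow>\<^sub>M borel"
proof -
  have "(\<lambda>y. y) \<in> states \<rightarrow>\<^sub>M (borel :: (real^'d) measure)" by (rule measurable_restrict_space1) simp
  from measurable_compose[OF measurable_fst this]
  have [measurable]: "fst \<in> states \<Otimes>\<^sub>M (borel :: (real^'d) measure) \<rightarrow>\<^sub>M borel" .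
  show ?thesis by (intro borel_measurable_add borel_measurable_scaleR) measurable
qed

text \<open>The first step from \<open>y\<close> is \<open>y + \<alpha> *\<^sub>R g\<close> with \<open>g\<close> distributed as \<open>K y\<close>: at time \<open>0\<close> the state is the
constant \<open>y\<close>, so that conditioning has no effect. This identifies \<open>trans_kernel\<close> with a quantity that
depends on \<open>y\<close> through \<open>K\<close> alone, and measurability in \<open>y\<close> follows.\<close>

lemma emeasure_trans_kernel:
  assumes y: "y \<in> \<Theta>" and B: "B \<in> sets borel"
  shows "emeasure (trans_kernel y) (\<Theta> \<inter> B) = emeasure (K y) {g. y + \<alpha> *\<^sub>R g \<in> B}"
proof -
  interpret P: prob_space "M y" by (rule prob_space_M[OF y])
  let ?C = "{z \<in> space (states \<Otimes>\<^sub>M borel). fst z + \<alpha> *\<^sub>R snd z \<in> B}"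
  have C: "?C \<in> sets (states \<Otimes>\<^sub>M borel)" using B step_measurable by simp
  have "emeasure (trans_kernel y) (\<Theta> \<inter> B) = emeasure (M y) (X y 1 -` (\<Theta> \<inter> B) \<inter> space (M y))"
    unfolding trans_kernel_def using B
    by (intro emeasure_distr measurable_X_states y) (auto simp: sets_restrict_space)
  also have "\<dots> = emeasure (M y) {\<omega> \<in> space (M y). (X y 0 \<omega>, G y 0 \<omega>) \<in> ?C}"
    using y X_0[OF y] X_Suc[OF y, of _ 0] X_in_states[OF y, of _ 1]
    by (intro arg_cong[where f = "emeasure (M y)"]) (auto simp: space_pair_measure)
  also have "\<dots> = (\<integral>\<^sup>+\<omega>. indicator (space (M y)) \<omega> * emeasure (K (X y 0 \<omega>)) (Pair (X y 0 \<omega>) -` ?C) \<partial>M y)"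
    by (rule joint_law[OF y _ C]) (metis sets.top space_natural_filtration)
  also have "\<dots> = (\<integral>\<^sup>+\<omega>. emeasure (K y) {g. y + \<alpha> *\<^sub>R g \<in> B} \<partial>M y)"
    using y by (intro nn_integral_cong) (auto simp: X_0[OF y] space_pair_measure vimage_def)
  finally show ?thesis by (simp add: P.emeasure_space_1)
qed

lemma trans_kernel_measurable: "trans_kernel \<in> states \<rightarrow>\<^sub>M subprob_algebra states"
proof (rule measurable_subprob_algebra)
  fix y assume "y \<in> space states"
  then have y: "y \<in> \<Theta>" by simp
  interpret P: prob_space "M y" by (rule prob_space_M[OF y])
  show "subprob_space (trans_kernel y)"
    unfolding trans_kernel_def
    by (intro prob_space_imp_subprob_space P.prob_space_distr measurable_X_states y)
  show "sets (trans_kernel y) = sets states" by (simp add: trans_kernel_def)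
next
  fix Z assume "Z \<in> sets states"
  then obtain B where B: "B \<in> sets borel" "Z = \<Theta> \<inter> B" by (auto simp: sets_restrict_space)
  have "(\<lambda>y. emeasure (K y) {g. y + \<alpha> *\<^sub>R g \<in> B}) \<in> borel_measurable states"
  proof (rule emeasure_measurable_subprob_algebra2[OF _ kernel_subprob])
    have "(SIGMA y:space states. {g. y + \<alpha> *\<^sub>R g \<in> B}) =
        (\<lambda>z. fst z + \<alpha> *\<^sub>R snd z) -` B \<inter> space (states \<Otimes>\<^sub>M borel)"
      by (auto simp: space_pair_measure)
    then show "(SIGMA y:space states. {g. y + \<alpha> *\<^sub>R g \<in> B}) \<in> sets (states \<Otimes>\<^sub>M borel)"
      using measurable_sets[OF step_measurable B(1)] by simp
  qed
  then show "(\<lambda>y. emeasure (trans_kernel y) Z) \<in> borel_measurable states"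
    by (subst measurable_cong[where g = "\<lambda>y. emeasure (K y) {g. y + \<alpha> *\<^sub>R g \<in> B}"])
       (simp_all add: B emeasure_trans_kernel)
qed

text \<open>Both \<open>joint_law\<close> and \<open>emeasure_trans_kernel\<close> express a step through \<open>K\<close>: the former for the process
started at \<open>x\<close> and observed at time \<open>m\<close>, the latter for a process started at the state that is reached.
Comparing them shows that, on \<open>A\<close>, the law of \<open>X x (Suc m)\<close> is the law of \<open>X x m\<close> followed by the
transition kernel.\<close>

lemma one_step:
  assumes x: "x \<in> \<Theta>" and A: "A \<in> sets (past x m)" and f: "f \<in> borel_measurable states"
  shows "(\<integral>\<^sup>+\<omega>. indicator A \<omega> * f (X x (Suc m) \<omega>) \<partial>M x) =
         (\<integral>\<^sup>+\<omega>. indicator A \<omega> * (\<integral>\<^sup>+z. f z \<partial>trans_kernel (X x m \<omega>)) \<partial>M x)"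
proof -
  note [measurable] = measurable_X_states[OF x] f trans_kernel_measurable
    and AM [measurable] = past_sets[OF x A]
  have A_sub: "A \<subseteq> space (M x)" by (rule sets.sets_into_space[OF AM])
  \<comment> \<open>The law of the state at time \<open>k\<close> on the event \<open>A\<close>, of
    total mass \<open>P(A)\<close>.\<close>
  define N where "N k = distr (density (M x) (indicator A)) states (X x k)" for k
  have inner [measurable]: "(\<lambda>y. \<integral>\<^sup>+z. f z \<partial>trans_kernel y) \<in> borel_measurable states"
    by (rule measurable_compose[OF trans_kernel_measurable nn_integral_measurable_subprob_algebra[OF f]])
  have N_int: "(\<integral>\<^sup>+y. h y \<partial>N k) = (\<integral>\<^sup>+\<omega>. indicator A \<omega> * h (X x k \<omega>) \<partial>M x)"
    if [measurable]: "h \<in> borel_measurable states" for h k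
    unfolding N_def by (simp add: nn_integral_distr nn_integral_density)
  have sets_N: "sets (N k) = sets states" for k by (simp add: N_def)
  have trans_N: "trans_kernel \<in> N k \<rightarrow>\<^sub>M subprob_algebra states" for k
    using trans_kernel_measurable by (simp add: sets_N cong: measurable_cong_sets)
  have "N (Suc m) = N m \<bind> trans_kernel"
  proof (rule measure_eqI)
    show "sets (N (Suc m)) = sets (N m \<bind> trans_kernel)"
      using x by (subst sets_bind[where N = states]) (auto simp: N_def trans_kernel_def)
    fix Z assume "Z \<in> sets (N (Suc m))"
    then have Z [measurable]: "Z \<in> sets states" by (simp add: N_def)
    then obtain B where B: "B \<in> sets borel" "Z = \<Theta> \<inter> B" by (auto simp: sets_restrict_space)
    let ?C = "{z \<in> space (states \<Otimes>\<^sub>M borel). fst z + \<alpha> *\<^sub>R snd z \<in> B}"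
    have C: "?C \<in> sets (states \<Otimes>\<^sub>M borel)" using B step_measurable by simp
    have stays: "X x m \<omega> + \<alpha> *\<^sub>R G x m \<omega> \<in> \<Theta>" if "\<omega> \<in> space (M x)" for \<omega>
      using X_in_states[OF x that, of "Suc m"] X_Suc[OF x that, of m] by simp
    have "emeasure (N (Suc m)) Z = (\<integral>\<^sup>+z. indicator Z z \<partial>N (Suc m))"
      using Z by (simp add: sets_N)
    also have "\<dots> = (\<integral>\<^sup>+\<omega>. indicator {\<omega> \<in> A. (X x m \<omega>, G x m \<omega>) \<in> ?C} \<omega> \<partial>M x)"
      unfolding N_int[OF borel_measurable_indicator[OF Z]]
      using X_in_states[OF x, of _ m] stays X_Suc[OF x]
      by (intro nn_integral_cong) (auto simp: B indicator_def space_pair_measure)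
    also have "\<dots> = emeasure (M x) {\<omega> \<in> A. (X x m \<omega>, G x m \<omega>) \<in> ?C}"
    proof (rule nn_integral_indicator)
      have "(\<lambda>\<omega>. (X x m \<omega>, G x m \<omega>)) -` ?C \<inter> space (M x) \<in> sets (M x)"
        by (intro measurable_sets[OF _ C] measurable_Pair measurable_X_states measurable_G x)
      moreover have "{\<omega> \<in> A. (X x m \<omega>, G x m \<omega>) \<in> ?C} = A \<inter> ((\<lambda>\<omega>. (X x m \<omega>, G x m \<omega>)) -` ?C \<inter> space (M x))"
        using A_sub by auto
      ultimately show "{\<omega> \<in> A. (X x m \<omega>, G x m \<omega>) \<in> ?C} \<in> sets (M x)"
        by (simp only: sets.Int AM)
    qed
    also have "\<dots> = (\<integral>\<^sup>+\<omega>. indicator A \<omega> * emeasure (K (X x m \<omega>)) (Pair (X x m \<omega>) -` ?C) \<partial>M x)"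
      by (rule joint_law[OF x A C])
    also have "\<dots> = (\<integral>\<^sup>+\<omega>. indicator A \<omega> * emeasure (trans_kernel (X x m \<omega>)) Z \<partial>M x)"
      using X_in_states[OF x]
      by (intro nn_integral_cong) (simp add: B emeasure_trans_kernel space_pair_measure vimage_def)
    also have "\<dots> = (\<integral>\<^sup>+y. emeasure (trans_kernel y) Z \<partial>N m)"
      by (rule N_int[symmetric]) measurable
    also have "\<dots> = emeasure (N m \<bind> trans_kernel) Z"
      using x by (intro emeasure_bind[symmetric, OF _ trans_N Z]) (auto simp: N_def)
    finally show "emeasure (N (Suc m)) Z = emeasure (N m \<bind> trans_kernel) Z" .
  qed
  then have "(\<integral>\<^sup>+z. f z \<partial>N (Suc m)) = (\<integral>\<^sup>+y. \<integral>\<^sup>+z. f z \<partial>trans_kernel y \<partial>N m)"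
    using nn_integral_bind[OF f trans_N] by simp
  then show ?thesis
    by (simp add: N_int)
qed

text \<open>Iterating \<open>one_step\<close> gives a function \<open>h\<close> that represents the expectation of \<open>f\<close> after \<open>n\<close> steps
simultaneously for all starting points, all times and all events of the past. Evaluating this
representation at time \<open>0\<close> on the whole space, where the state is the starting point itself,
identifies \<open>h y\<close> with the expectation of \<open>f (X y n)\<close>.\<close>

lemma markov_property:
  assumes f: "f \<in> borel_measurable states"
    and x: "x \<in> \<Theta>" and A: "A \<in> sets (past x m)"
  shows "(\<integral>\<^sup>+\<omega>. indicator A \<omega> * f (X x (m + n) \<omega>) \<partial>M x) =
         (\<integral>\<^sup>+\<omega>. indicator A \<omega> * (\<integral>\<^sup>+\<omega>'. f (X (X x m \<omega>) n \<omega>') \<partial>M (X x m \<omega>)) \<partial>M x)"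
proof -
  have "\<exists>h. \<forall>x\<in>\<Theta>. \<forall>m. \<forall>A\<in>sets (past x m).
      (\<integral>\<^sup>+\<omega>. indicator A \<omega> * f (X x (m + n) \<omega>) \<partial>M x) = (\<integral>\<^sup>+\<omega>. indicator A \<omega> * h (X x m \<omega>) \<partial>M x)"
    using f
  proof (induction n arbitrary: f)
    case 0
    then show ?case by auto
  next
    case (Suc n)
    let ?f = "\<lambda>y. \<integral>\<^sup>+z. f z \<partial>trans_kernel y"
    have "?f \<in> borel_measurable states"
      by (rule measurable_compose[OF trans_kernel_measurable nn_integral_measurable_subprob_algebra[OF Suc.prems]])
    from Suc.IH[OF this] obtain h where h: "\<And>x m A. x \<in> \<Theta> \<Longrightarrow> A \<in> sets (past x m) \<Longrightarrow>
        (\<integral>\<^sup>+\<omega>. indicator A \<omega> * ?f (X x (m + n) \<omega>) \<partial>M x) = (\<integral>\<^sup>+\<omega>. indicator A \<omega> * h (X x m \<omega>) \<partial>M x)"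
      by blast
    have "(\<integral>\<^sup>+\<omega>. indicator A \<omega> * f (X x (m + Suc n) \<omega>) \<partial>M x) =
        (\<integral>\<^sup>+\<omega>. indicator A \<omega> * h (X x m \<omega>) \<partial>M x)" if "x \<in> \<Theta>" "A \<in> sets (past x m)" for x m A
      using one_step[OF that(1) _ Suc.prems, of A "m + n"] h[OF that] that(2)
        natural_filtration_mono[of m "m + n" "M x" "X x"] by auto
    then show ?case by blast
  qed
  then obtain h where h: "\<And>x m A. x \<in> \<Theta> \<Longrightarrow> A \<in> sets (past x m) \<Longrightarrow>
      (\<integral>\<^sup>+\<omega>. indicator A \<omega> * f (X x (m + n) \<omega>) \<partial>M x) = (\<integral>\<^sup>+\<omega>. indicator A \<omega> * h (X x m \<omega>) \<partial>M x)"
    by blast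
  have "h y = (\<integral>\<^sup>+\<omega>'. f (X y n \<omega>') \<partial>M y)" if y: "y \<in> \<Theta>" for y
  proof -
    interpret P: prob_space "M y" by (rule prob_space_M[OF y])
    have "(\<integral>\<^sup>+\<omega>. indicator (space (M y)) \<omega> * f (X y (0 + n) \<omega>) \<partial>M y) =
        (\<integral>\<^sup>+\<omega>. indicator (space (M y)) \<omega> * h (X y 0 \<omega>) \<partial>M y)"
      by (rule h[OF y]) (metis sets.top space_natural_filtration)
    also have "\<dots> = (\<integral>\<^sup>+\<omega>. h y \<partial>M y)"
      by (intro nn_integral_cong) (simp add: X_0[OF y])
    finally show ?thesis
      by (simp add: P.emeasure_space_1 cong: nn_integral_cong)
  qed
  with h[OF x A] X_in_states[OF x] show ?thesis
    by (simp cong: nn_integral_cong)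
qed

end

section \<open>Decay of a Lyapunov function along blocks\<close>

text \<open>The flow enters the argument only through the drift inequality: from \<open>U\<close>, the expectation of the
Lyapunov function \<open>\<Psi>\<close> after \<open>n\<close> steps is at most \<open>c n\<close> times its initial value. The sublevel set
of height \<open>\<zeta>\<close> ties the size of \<open>\<Psi>\<close> to membership in \<open>U\<close>.\<close>

locale lyapunov_drift = algorithm_family \<Theta> K \<alpha> M X G
  for \<Theta> :: "(real^'d) set" and K \<alpha> and M :: "real^'d \<Rightarrow> 'w measure" and X G +
  fixes U :: "(real^'d) set"
    and \<Psi> :: "real^'d \<Rightarrow> real"
    and \<zeta> :: real
    and c :: "nat \<Rightarrow> real"
    and N :: nat
  assumes Psi_measurable: "\<Psi> \<in> borel_measurable (restrict_space borel \<Theta>)"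
    and Psi_nonneg: "x \<in> \<Theta> \<Longrightarrow> 0 \<le> \<Psi> x"
    and U_open: "openin (top_of_set \<Theta>) U"
    and zeta_pos: "0 < \<zeta>"
    and sublevel: "x \<in> \<Theta> \<Longrightarrow> \<Psi> x < \<zeta> \<Longrightarrow> x \<in> U"
    and c_nonneg: "1 \<le> n \<Longrightarrow> 0 \<le> c n"
    and N_pos: "1 \<le> N"
    and drift: "x \<in> U \<Longrightarrow> 1 \<le> n \<Longrightarrow>
          (\<integral>\<^sup>+\<omega>. ennreal (\<Psi> (X x n \<omega>)) \<partial>M x) \<le> ennreal (c n * \<Psi> x)"
begin

abbreviation stays :: "real^'d \<Rightarrow> nat \<Rightarrow> 'w set" where
  "stays x \<equiv> stay_event (M x) (X x) U N"

lemma U_subset: "U \<subseteq> \<Theta>"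
  using openin_imp_subset[OF U_open] by simp

lemma c_N_nonneg: "0 \<le> c N"
  by (rule c_nonneg[OF N_pos])

lemma X_in_U_past:
  assumes x: "x \<in> \<Theta>" and "i \<le> m"
  shows "{\<omega> \<in> space (M x). X x i \<omega> \<in> U} \<in> sets (past x m)"
proof -
  obtain V where V: "open V" "U = \<Theta> \<inter> V"
    using U_open by (auto simp: openin_open)
  have "{\<omega> \<in> space (M x). X x i \<omega> \<in> U} = X x i -` V \<inter> space (past x m)"
    using X_in_states[OF x] by (auto simp: V(2))
  then show ?thesis
    using measurable_sets[OF measurable_natural_filtration[OF \<open>i \<le> m\<close>], of V "X x" "M x"] V(1) by simp
qed

lemma stays_past:
  assumes x: "x \<in> \<Theta>"
  shows "stays x k \<in> sets (past x (k * N))"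
proof -
  have "stays x k = (\<Inter>i\<in>{..k}. {\<omega> \<in> space (M x). X x (i * N) \<omega> \<in> U})"
    by (auto simp: stay_event_def)
  also have "\<dots> \<in> sets (past x (k * N))"
    by (intro sets.finite_INT X_in_U_past x) auto
  finally show ?thesis .
qed

lemma stays_antimono: "j \<le> k \<Longrightarrow> stays x k \<subseteq> stays x j"
  by (auto simp: stay_event_def)

text \<open>The Markov property turns the drift inequality, which speaks of deterministic starting points, into one
for the state at time \<open>m\<close>, on events of the past that force this state into \<open>U\<close>.\<close>

lemma drift_step:
  assumes x: "x \<in> \<Theta>" and A: "A \<in> sets (past x m)" and in_U: "\<And>\<omega>. \<omega> \<in> A \<Longrightarrow> X x m \<omega> \<in> U"
    and n: "1 \<le> n"
  shows "(\<integral>\<^sup>+\<omega>. indicator A \<omega> * ennreal (\<Psi> (X x (m + n) \<omega>)) \<partial>M x) \<le>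
         ennreal (c n) * (\<integral>\<^sup>+\<omega>. indicator A \<omega> * ennreal (\<Psi> (X x m \<omega>)) \<partial>M x)"
proof -
  note [measurable] = measurable_X_states[OF x] Psi_measurable past_sets[OF x A]
  have "(\<integral>\<^sup>+\<omega>. indicator A \<omega> * ennreal (\<Psi> (X x (m + n) \<omega>)) \<partial>M x) =
      (\<integral>\<^sup>+\<omega>. indicator A \<omega> * (\<integral>\<^sup>+\<omega>'. ennreal (\<Psi> (X (X x m \<omega>) n \<omega>')) \<partial>M (X x m \<omega>)) \<partial>M x)"
    by (rule markov_property[OF _ x A]) measurable
  also have "\<dots> \<le> (\<integral>\<^sup>+\<omega>. ennreal (c n) * (indicator A \<omega> * ennreal (\<Psi> (X x m \<omega>))) \<partial>M x)"
    using drift[OF in_U n] c_nonneg[OF n]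
    by (intro nn_integral_mono) (auto simp: indicator_def simp flip: ennreal_mult')
  also have "\<dots> = ennreal (c n) * (\<integral>\<^sup>+\<omega>. indicator A \<omega> * ennreal (\<Psi> (X x m \<omega>)) \<partial>M x)"
    by (rule nn_integral_cmult) measurable
  finally show ?thesis .
qed

lemma X_in_U_on_stays: "\<omega> \<in> stays x k \<Longrightarrow> X x (k * N) \<omega> \<in> U"
  by (auto simp: stay_event_def)

text \<open>The event \<open>stays x k\<close> forces the state at the end of block \<open>k\<close> into \<open>U\<close>, so another block
contracts by \<open>c N\<close>; restricting to the smaller event \<open>stays x (Suc k)\<close> only decreases the integral.\<close>

lemma decay_at_blocks:
  assumes x: "x \<in> U"
  shows "(\<integral>\<^sup>+\<omega>. indicator (stays x k) \<omega> * ennreal (\<Psi> (X x (k * N) \<omega>)) \<partial>M x) \<le> ennreal (c N ^ k * \<Psi> x)"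
proof (induction k)
  case 0
  have x': "x \<in> \<Theta>" using x U_subset by auto
  interpret P: prob_space "M x" by (rule prob_space_M[OF x'])
  have "(\<integral>\<^sup>+\<omega>. indicator (stays x 0) \<omega> * ennreal (\<Psi> (X x (0 * N) \<omega>)) \<partial>M x) \<le> (\<integral>\<^sup>+\<omega>. ennreal (\<Psi> x) \<partial>M x)"
    by (intro nn_integral_mono) (simp add: X_0[OF x'] indicator_def)
  then show ?case by (simp add: P.emeasure_space_1)
next
  case (Suc k)
  have x': "x \<in> \<Theta>" using x U_subset by auto
  have "(\<integral>\<^sup>+\<omega>. indicator (stays x (Suc k)) \<omega> * ennreal (\<Psi> (X x (Suc k * N) \<omega>)) \<partial>M x) \<le>
      (\<integral>\<^sup>+\<omega>. indicator (stays x k) \<omega> * ennreal (\<Psi> (X x (k * N + N) \<omega>)) \<partial>M x)"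
    using stays_antimono[of k "Suc k" x]
    by (intro nn_integral_mono) (auto simp: indicator_def add.commute)
  also have "\<dots> \<le> ennreal (c N) * (\<integral>\<^sup>+\<omega>. indicator (stays x k) \<omega> * ennreal (\<Psi> (X x (k * N) \<omega>)) \<partial>M x)"
    by (rule drift_step[OF x' stays_past[OF x'] X_in_U_on_stays N_pos])
  also have "\<dots> \<le> ennreal (c N) * ennreal (c N ^ k * \<Psi> x)"
    by (intro mult_left_mono Suc.IH) simp
  also have "\<dots> = ennreal (c N ^ Suc k * \<Psi> x)"
    by (simp add: c_N_nonneg Psi_nonneg x' mult.assoc flip: ennreal_mult)
  finally show ?case .
qed

lemma decay_within_block:
  assumes x: "x \<in> U" and r: "1 \<le> r"
  shows "(\<integral>\<^sup>+\<omega>. indicator (stays x k) \<omega> * ennreal (\<Psi> (X x (k * N + r) \<omega>)) \<partial>M x) \<le>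
         ennreal (c r * c N ^ k * \<Psi> x)"
proof -
  have x': "x \<in> \<Theta>" using x U_subset by auto
  have "(\<integral>\<^sup>+\<omega>. indicator (stays x k) \<omega> * ennreal (\<Psi> (X x (k * N + r) \<omega>)) \<partial>M x) \<le>
      ennreal (c r) * (\<integral>\<^sup>+\<omega>. indicator (stays x k) \<omega> * ennreal (\<Psi> (X x (k * N) \<omega>)) \<partial>M x)"
    by (rule drift_step[OF x' stays_past[OF x'] X_in_U_on_stays r])
  also have "\<dots> \<le> ennreal (c r) * ennreal (c N ^ k * \<Psi> x)"
    by (intro mult_left_mono decay_at_blocks x) simp
  also have "\<dots> = ennreal (c r * c N ^ k * \<Psi> x)"
    using c_nonneg[OF r] by (simp add: c_N_nonneg Psi_nonneg x' mult.assoc flip: ennreal_mult)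
  finally show ?thesis .
qed

text \<open>Markov's inequality on the part of \<open>A\<close> where \<open>\<Psi>\<close> is at least \<open>e\<close>.\<close>

lemma prob_large_Psi:
  assumes x: "x \<in> \<Theta>" and A: "A \<in> sets (M x)" and e: "0 < e" and b: "0 \<le> b"
    and bound: "(\<integral>\<^sup>+\<omega>. indicator A \<omega> * ennreal (\<Psi> (X x n \<omega>)) \<partial>M x) \<le> ennreal b"
  shows "measure (M x) A \<le> measure (M x) {\<omega> \<in> A. \<Psi> (X x n \<omega>) < e} + b / e"
proof -
  interpret P: prob_space "M x" by (rule prob_space_M[OF x])
  have [measurable]: "(\<lambda>\<omega>. \<Psi> (X x n \<omega>)) \<in> borel_measurable (M x)"
    by (rule measurable_compose[OF measurable_X_states[OF x] Psi_measurable])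
  note [measurable] = A
  have A_eq: "{\<omega> \<in> A. Q \<omega>} = {\<omega> \<in> space (M x). \<omega> \<in> A \<and> Q \<omega>}" for Q
    using sets.sets_into_space[OF A] by auto
  have small: "{\<omega> \<in> A. \<Psi> (X x n \<omega>) < e} \<in> sets (M x)"
    and large: "{\<omega> \<in> A. e \<le> \<Psi> (X x n \<omega>)} \<in> sets (M x)"
    unfolding A_eq by measurable
  have "ennreal e * emeasure (M x) {\<omega> \<in> A. e \<le> \<Psi> (X x n \<omega>)} =
      (\<integral>\<^sup>+\<omega>. ennreal e * indicator {\<omega> \<in> A. e \<le> \<Psi> (X x n \<omega>)} \<omega> \<partial>M x)"
    by (rule nn_integral_cmult_indicator[OF large, symmetric])
  also have "\<dots> \<le> (\<integral>\<^sup>+\<omega>. indicator A \<omega> * ennreal (\<Psi> (X x n \<omega>)) \<partial>M x)"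
    by (intro nn_integral_mono) (auto simp: indicator_def ennreal_leI)
  also note bound
  finally have "e * P.prob {\<omega> \<in> A. e \<le> \<Psi> (X x n \<omega>)} \<le> b"
    using e b by (simp add: P.emeasure_eq_measure flip: ennreal_mult)
  then have "P.prob {\<omega> \<in> A. e \<le> \<Psi> (X x n \<omega>)} \<le> b / e"
    using e by (simp add: field_simps)
  moreover have "P.prob A = P.prob ({\<omega> \<in> A. \<Psi> (X x n \<omega>) < e} \<union> {\<omega> \<in> A. e \<le> \<Psi> (X x n \<omega>)})"
    by (rule arg_cong[where f = P.prob]) auto
  moreover have "\<dots> \<le> P.prob {\<omega> \<in> A. \<Psi> (X x n \<omega>) < e} + P.prob {\<omega> \<in> A. e \<le> \<Psi> (X x n \<omega>)}"
    by (rule measure_Un_le[OF small large])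
  ultimately show ?thesis by linarith
qed

text \<open>A path that has stayed in \<open>U\<close> up to block \<open>k\<close> and is outside \<open>U\<close> at the end of the next block has
\<open>\<Psi> \<ge> \<zeta>\<close> there. By Markov's inequality and the decay of \<open>\<Psi>\<close> on \<open>stays x k\<close> this has
probability at most \<open>c N ^ Suc k * \<Psi> x / \<zeta>\<close>.\<close>

lemma prob_stays_sum:
  assumes x: "x \<in> U"
  shows "1 - \<Psi> x / \<zeta> * (\<Sum>j=1..k. c N ^ j) \<le> measure (M x) (stays x k)"
proof (induction k)
  case 0
  have x': "x \<in> \<Theta>" using x U_subset by auto
  interpret P: prob_space "M x" by (rule prob_space_M[OF x'])
  have "stays x 0 = space (M x)" using x by (auto simp: stay_event_def X_0[OF x'])
  then show ?case by (simp add: P.prob_space)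
next
  case (Suc k)
  have x': "x \<in> \<Theta>" using x U_subset by auto
  interpret P: prob_space "M x" by (rule prob_space_M[OF x'])
  have meas: "stays x j \<in> sets (M x)" for j by (rule past_sets[OF x' stays_past[OF x']])
  have "P.prob (stays x k) \<le>
      P.prob {\<omega> \<in> stays x k. \<Psi> (X x (k * N + N) \<omega>) < \<zeta>} + c N * c N ^ k * \<Psi> x / \<zeta>"
    using zeta_pos c_N_nonneg Psi_nonneg[OF x']
    by (intro prob_large_Psi x' meas decay_within_block x N_pos) auto
  also have "P.prob {\<omega> \<in> stays x k. \<Psi> (X x (k * N + N) \<omega>) < \<zeta>} \<le> P.prob (stays x (Suc k))"
  proof (intro P.finite_measure_mono meas subsetI)
    fix \<omega> assume \<omega>: "\<omega> \<in> {\<omega> \<in> stays x k. \<Psi> (X x (k * N + N) \<omega>) < \<zeta>}"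
    then have "X x (Suc k * N) \<omega> \<in> U"
      using sublevel[OF X_in_states[OF x']] by (auto simp: stay_event_def add.commute)
    with \<omega> show "\<omega> \<in> stays x (Suc k)" by (auto simp: stay_event_def le_Suc_eq)
  qed
  finally have "P.prob (stays x k) - \<Psi> x / \<zeta> * c N ^ Suc k \<le> P.prob (stays x (Suc k))"
    by (simp add: field_simps)
  with Suc.IH show ?case by (simp add: algebra_simps)
qed

lemma prob_stays:
  assumes x: "x \<in> U" and cN: "c N < 1"
  shows "1 - \<Psi> x / \<zeta> * ((c N - c N ^ (k + 1)) / (1 - c N)) \<le> measure (M x) (stays x k)"
proof -
  have "(1 - c N) * (\<Sum>j=1..k. c N ^ j) = c N - c N ^ (k + 1)"
  proof (induction k)
    case (Suc k)
    have "(1 - c N) * (\<Sum>j=1..Suc k. c N ^ j) = (1 - c N) * (\<Sum>j=1..k. c N ^ j) + (1 - c N) * c N ^ Suc k"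
      by (simp add: distrib_left)
    also have "\<dots> = c N - c N ^ (Suc k + 1)"
      unfolding Suc.IH by (simp add: algebra_simps)
    finally show ?case .
  qed simp
  then have "(\<Sum>j=1..k. c N ^ j) = (c N - c N ^ (k + 1)) / (1 - c N)"
    using cN by (simp add: field_simps)
  then show ?thesis using prob_stays_sum[OF x, of k] by simp
qed

lemma prob_stays_forever:
  assumes x: "x \<in> U" and cN: "c N < 1"
  shows "1 - \<Psi> x / \<zeta> * (c N / (1 - c N)) \<le> measure (M x) (\<Inter>k. stays x k)"
proof -
  have x': "x \<in> \<Theta>" using x U_subset by auto
  interpret P: prob_space "M x" by (rule prob_space_M[OF x'])
  have "(\<lambda>k. P.prob (stays x k)) \<longlonglongrightarrow> P.prob (\<Inter>k. stays x k)"
    using past_sets[OF x' stays_past[OF x']] stays_antimono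
    by (intro P.finite_Lim_measure_decseq) (auto simp: decseq_def)
  moreover have "1 - \<Psi> x / \<zeta> * (c N / (1 - c N)) \<le> P.prob (stays x k)" for k
  proof -
    have "(c N - c N ^ (k + 1)) / (1 - c N) \<le> c N / (1 - c N)"
      using cN c_N_nonneg by (intro divide_right_mono) auto
    then have "\<Psi> x / \<zeta> * ((c N - c N ^ (k + 1)) / (1 - c N)) \<le> \<Psi> x / \<zeta> * (c N / (1 - c N))"
      using zeta_pos Psi_nonneg[OF x'] by (intro mult_left_mono) auto
    then show ?thesis using prob_stays[OF x cN, of k] by linarith
  qed
  ultimately show ?thesis by (intro LIMSEQ_le_const) auto
qed

end

section \<open>Convergence of the stochastic algorithm\<close>

theorem theorem17:
  fixes \<Theta> U :: "(real^'d) set"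
    and S :: "real set"
    and K :: "real \<Rightarrow> real^'d \<Rightarrow> (real^'d) measure"
    and F :: "real^'d \<Rightarrow> real^'d"
    and M :: "real \<Rightarrow> real^'d \<Rightarrow> 'w measure"
    and X G :: "real \<Rightarrow> real^'d \<Rightarrow> nat \<Rightarrow> 'w \<Rightarrow> real^'d"
    and \<phi> :: "real \<Rightarrow> real^'d \<Rightarrow> real^'d"
    and \<Psi> :: "real^'d \<Rightarrow> real"
    and \<zeta> :: real
    and \<Delta>\<^sub>3 :: "real \<Rightarrow> real"
    and \<Delta>\<^sub>4 :: "real \<Rightarrow> real \<Rightarrow> real"
  assumes step_sizes: "S \<subseteq> {0<..}" "\<forall>\<^sub>F \<alpha> in at_right 0. \<alpha> \<in> S"
    and kernel: "\<And>\<alpha>. \<alpha> \<in> S \<Longrightarrow> K \<alpha> \<in> restrict_space borel \<Theta> \<rightarrow>\<^sub>M prob_algebra borel"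
    and mean_field: "\<And>\<alpha> x. \<alpha> \<in> S \<Longrightarrow> x \<in> \<Theta> \<Longrightarrow> has_bochner_integral (K \<alpha> x) (\<lambda>y. y) (F x)"
    and algorithm: "\<And>\<alpha> x. \<alpha> \<in> S \<Longrightarrow> x \<in> \<Theta> \<Longrightarrow>
          stochastic_algorithm \<Theta> (K \<alpha>) \<alpha> x (M \<alpha> x) (X \<alpha> x) (G \<alpha> x)"
    and flow: "mean_ode_flow \<Theta> F \<phi>"
    and Psi: "\<Psi> \<in> borel_measurable (restrict_space borel \<Theta>)" "\<And>x. x \<in> \<Theta> \<Longrightarrow> 0 \<le> \<Psi> x"
    and U: "openin (top_of_set \<Theta>) U" "0 < \<zeta>" "{x\<in>\<Theta>. \<Psi> x < \<zeta>} \<subseteq> U"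
    and Delta3: "\<And>t. 0 \<le> t \<Longrightarrow> 0 \<le> \<Delta>\<^sub>3 t" "antimono_on {0..} \<Delta>\<^sub>3" "(\<Delta>\<^sub>3 \<longlongrightarrow> 0) at_top"
    and A3: "\<And>x t. x \<in> U \<Longrightarrow> 0 \<le> t \<Longrightarrow> \<Psi> (\<phi> t x) \<le> \<Delta>\<^sub>3 t * \<Psi> x"
    and Delta4: "\<And>\<alpha> T. 0 < \<alpha> \<Longrightarrow> 0 < T \<Longrightarrow> 0 < \<Delta>\<^sub>4 \<alpha> T"
          "\<And>T. 0 < T \<Longrightarrow> mono_on {0<..} (\<lambda>\<alpha>. \<Delta>\<^sub>4 \<alpha> T)"
          "\<And>\<alpha>. 0 < \<alpha> \<Longrightarrow> mono_on {0<..} (\<Delta>\<^sub>4 \<alpha>)"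
          "\<And>T. 0 < T \<Longrightarrow> ((\<lambda>\<alpha>. \<Delta>\<^sub>4 \<alpha> T) \<longlongrightarrow> 0) (at_right 0)"
    and A4: "\<And>\<alpha> N x. \<alpha> \<in> S \<Longrightarrow> 1 \<le> N \<Longrightarrow> x \<in> U \<Longrightarrow>
          (\<integral>\<^sup>+\<omega>. ennreal (\<Psi> (X \<alpha> x N \<omega>)) \<partial>M \<alpha> x)
            \<le> ennreal (\<Psi> (\<phi> (real N * \<alpha>) x) + \<Delta>\<^sub>4 \<alpha> (real N * \<alpha>) * \<Psi> x)"
  shows "good_steps S \<Delta>\<^sub>3 \<Delta>\<^sub>4 \<noteq> {} \<and>
    (\<forall>\<alpha>\<in>good_steps S \<Delta>\<^sub>3 \<Delta>\<^sub>4.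
      (\<exists>N\<ge>1. contraction \<Delta>\<^sub>3 \<Delta>\<^sub>4 \<alpha> N powr (1 / real N) = rate \<Delta>\<^sub>3 \<Delta>\<^sub>4 \<alpha> \<and> rate \<Delta>\<^sub>3 \<Delta>\<^sub>4 \<alpha> < 1) \<and>
      (\<forall>\<theta>\<^sub>0\<in>U.
        let \<gamma> = rate \<Delta>\<^sub>3 \<Delta>\<^sub>4 \<alpha>;
            N = block_length \<Delta>\<^sub>3 \<Delta>\<^sub>4 \<alpha>;
            \<gamma>' = block_max \<Delta>\<^sub>3 \<Delta>\<^sub>4 \<alpha>;
            P = M \<alpha> \<theta>\<^sub>0;
            \<theta> = X \<alpha> \<theta>\<^sub>0;
            \<Omega> = stay_event P \<theta> U N
        in (\<forall>k. measure P (\<Omega> k) \<ge> 1 - \<Psi> \<theta>\<^sub>0 / \<zeta> * ((\<gamma> ^ N - \<gamma> ^ (N * (k + 1))) / (1 - \<gamma> ^ N))) \<and>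
           measure P (\<Inter>k. \<Omega> k) \<ge> 1 - \<Psi> \<theta>\<^sub>0 / \<zeta> * (\<gamma> ^ N / (1 - \<gamma> ^ N)) \<and>
           (\<forall>n\<ge>1. (\<integral>\<^sup>+\<omega>. ennreal (\<Psi> (\<theta> n \<omega>) * indicator (\<Omega> ((n - 1) div N)) \<omega>) \<partial>P)
                     \<le> ennreal (\<gamma>' / \<gamma> ^ (N - 1) * \<gamma> ^ n * \<Psi> \<theta>\<^sub>0)) \<and>
           (\<forall>n\<ge>1. \<forall>\<epsilon>>0. measure P {\<omega>\<in>space P. \<Psi> (\<theta> n \<omega>) < \<epsilon>}
                     \<ge> measure P (\<Omega> ((n - 1) div N)) - \<Psi> \<theta>\<^sub>0 / \<epsilon> * \<gamma> ^ n * (\<gamma>' / \<gamma> ^ (N - 1)))))"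
proof (intro conjI ballI)
  show "good_steps S \<Delta>\<^sub>3 \<Delta>\<^sub>4 \<noteq> {}"
    by (rule good_steps_nonempty[OF step_sizes Delta3(1,3) Delta4(1,3,4)])
next
  fix \<alpha> assume "\<alpha> \<in> good_steps S \<Delta>\<^sub>3 \<Delta>\<^sub>4"
  then have pos: "0 < \<alpha>" and rate: "rate \<Delta>\<^sub>3 \<Delta>\<^sub>4 \<alpha> < 1"
    by (auto simp: good_steps_def)
  note facts = pos rate Delta3(1) Delta4(1,3)
  show "\<exists>N\<ge>1. contraction \<Delta>\<^sub>3 \<Delta>\<^sub>4 \<alpha> N powr (1 / real N) = rate \<Delta>\<^sub>3 \<Delta>\<^sub>4 \<alpha> \<and> rate \<Delta>\<^sub>3 \<Delta>\<^sub>4 \<alpha> < 1"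
    using block_length_ge_1[OF facts] block_length_attains[OF facts] rate by blast
next
  fix \<alpha> x assume "\<alpha> \<in> good_steps S \<Delta>\<^sub>3 \<Delta>\<^sub>4" and x: "x \<in> U"
  then have S: "\<alpha> \<in> S" and pos: "0 < \<alpha>" and rate: "rate \<Delta>\<^sub>3 \<Delta>\<^sub>4 \<alpha> < 1"
    by (auto simp: good_steps_def)
  note facts = pos rate Delta3(1) Delta4(1,3)
  define \<gamma> where "\<gamma> = rate \<Delta>\<^sub>3 \<Delta>\<^sub>4 \<alpha>"
  define N where "N = block_length \<Delta>\<^sub>3 \<Delta>\<^sub>4 \<alpha>"
  define c where "c = contraction \<Delta>\<^sub>3 \<Delta>\<^sub>4 \<alpha>"
  define \<gamma>' where "\<gamma>' = block_max \<Delta>\<^sub>3 \<Delta>\<^sub>4 \<alpha>"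
  note defs = \<gamma>_def[symmetric] N_def[symmetric] c_def[symmetric] \<gamma>'_def[symmetric]
  have N: "1 \<le> N" and \<gamma>: "0 < \<gamma>" "\<gamma> < 1" and cN: "c N = \<gamma> ^ N"
    and c_pos: "\<And>n. 1 \<le> n \<Longrightarrow> 0 < c n"
    and c_within: "\<And>r. 1 \<le> r \<Longrightarrow> r \<le> N \<Longrightarrow> c r \<le> \<gamma>' / \<gamma> ^ (N - 1) * \<gamma> ^ r"
    using block_length_ge_1[OF facts] rate_pos[OF facts] rate contraction_block[OF facts]
      contraction_pos[OF facts] contraction_within_block[OF facts]
    by (auto simp: defs)
  interpret lyapunov_drift \<Theta> "K \<alpha>" \<alpha> "M \<alpha>" "X \<alpha>" "G \<alpha>" U \<Psi> \<zeta> c N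
  proof unfold_locales
    fix y and n :: nat assume y: "y \<in> U" and n: "1 \<le> n"
    have "\<Psi> (\<phi> (real n * \<alpha>) y) \<le> \<Delta>\<^sub>3 (real n * \<alpha>) * \<Psi> y"
      by (rule A3[OF y]) (use pos in simp)
    then have "\<Psi> (\<phi> (real n * \<alpha>) y) + \<Delta>\<^sub>4 \<alpha> (real n * \<alpha>) * \<Psi> y \<le> c n * \<Psi> y"
      by (simp add: c_def contraction_def algebra_simps)
    then show "(\<integral>\<^sup>+\<omega>. ennreal (\<Psi> (X \<alpha> y n \<omega>)) \<partial>M \<alpha> y) \<le> ennreal (c n * \<Psi> y)"
      by (intro order_trans[OF A4[OF S n y]] ennreal_leI)
  qed (use kernel[OF S] algorithm[OF S] Psi U N c_pos in \<open>auto intro: less_imp_le\<close>)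
  have x': "x \<in> \<Theta>" using x U_subset by auto
  interpret P: prob_space "M \<alpha> x" by (rule prob_space_M[OF x'])
  have cN1: "c N < 1" using \<gamma> N by (simp add: cN power_less_one_iff)
  have pow: "\<gamma> ^ (N * j) = c N ^ j" for j by (simp add: cN power_mult)
  \<comment> \<open>Time \<open>n\<close> is written as complete blocks followed by a remainder
    between \<open>1\<close> and \<open>N\<close> rather than between \<open>0\<close> and \<open>N
    - 1\<close>: this is why \<open>n - 1\<close> is divided by \<open>N\<close>, and it ensures
    that the last, possibly incomplete, block has a contraction factor.\<close>
  have coeff: "0 \<le> \<gamma>' / \<gamma> ^ (N - 1) * \<gamma> ^ n" "n = ((n - 1) div N) * N + ((n - 1) mod N + 1)"
      "c ((n - 1) mod N + 1) * c N ^ ((n - 1) div N) \<le> \<gamma>' / \<gamma> ^ (N - 1) * \<gamma> ^ n"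
    if n: "1 \<le> n" for n
  proof -
    let ?k = "(n - 1) div N" and ?r = "(n - 1) mod N + 1"
    show split: "n = ?k * N + ?r" using n by simp
    have "c ?r * c N ^ ?k \<le> \<gamma>' / \<gamma> ^ (N - 1) * \<gamma> ^ ?r * c N ^ ?k"
      using N cN \<gamma> mod_less_divisor[of N "n - 1"] by (intro mult_right_mono c_within) (auto simp: Suc_le_eq)
    also have "\<dots> = \<gamma>' / \<gamma> ^ (N - 1) * \<gamma> ^ (?k * N + ?r)"
      unfolding pow[symmetric] power_add by (simp only: mult_ac)
    also have "\<gamma> ^ (?k * N + ?r) = \<gamma> ^ n"
      by (rule arg_cong[OF split, symmetric])
    finally show *: "c ?r * c N ^ ?k \<le> \<gamma>' / \<gamma> ^ (N - 1) * \<gamma> ^ n" .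
    have "0 \<le> c ?r * c N ^ ?k" using c_pos[of ?r] c_pos[OF N] by simp
    with * show "0 \<le> \<gamma>' / \<gamma> ^ (N - 1) * \<gamma> ^ n" by linarith
  qed
  have decay: "(\<integral>\<^sup>+\<omega>. indicator (stays x ((n - 1) div N)) \<omega> * ennreal (\<Psi> (X \<alpha> x n \<omega>)) \<partial>M \<alpha> x)
      \<le> ennreal (\<gamma>' / \<gamma> ^ (N - 1) * \<gamma> ^ n * \<Psi> x)" if n: "1 \<le> n" for n
  proof -
    let ?k = "(n - 1) div N" and ?r = "(n - 1) mod N + 1"
    have "(\<integral>\<^sup>+\<omega>. indicator (stays x ?k) \<omega> * ennreal (\<Psi> (X \<alpha> x (?k * N + ?r) \<omega>)) \<partial>M \<alpha> x)
        \<le> ennreal (c ?r * c N ^ ?k * \<Psi> x)"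
      by (rule decay_within_block[OF x]) simp
    also have "\<dots> \<le> ennreal (\<gamma>' / \<gamma> ^ (N - 1) * \<gamma> ^ n * \<Psi> x)"
      by (intro ennreal_leI mult_right_mono coeff n Psi_nonneg x')
    finally show ?thesis using coeff(2)[OF n] by simp
  qed
  have exit: "1 - \<Psi> x / \<zeta> * ((\<gamma> ^ N - \<gamma> ^ (N * (k + 1))) / (1 - \<gamma> ^ N)) \<le> P.prob (stays x k)" for k
    using prob_stays[OF x cN1, of k] by (simp only: pow cN)
  have exit_inf: "1 - \<Psi> x / \<zeta> * (\<gamma> ^ N / (1 - \<gamma> ^ N)) \<le> P.prob (\<Inter>k. stays x k)"
    using prob_stays_forever[OF x cN1] by (simp only: cN)
  have decay': "(\<integral>\<^sup>+\<omega>. ennreal (\<Psi> (X \<alpha> x n \<omega>) * indicator (stays x ((n - 1) div N)) \<omega>) \<partial>M \<alpha> x)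
      \<le> ennreal (\<gamma>' / \<gamma> ^ (N - 1) * \<gamma> ^ n * \<Psi> x)" if n: "1 \<le> n" for n
    by (rule order_trans[OF _ decay[OF n]]) (auto intro!: nn_integral_mono simp: indicator_def)
  have small: "P.prob (stays x ((n - 1) div N)) - \<Psi> x / \<epsilon> * \<gamma> ^ n * (\<gamma>' / \<gamma> ^ (N - 1))
      \<le> P.prob {\<omega> \<in> space (M \<alpha> x). \<Psi> (X \<alpha> x n \<omega>) < \<epsilon>}" if n: "1 \<le> n" and \<epsilon>: "0 < \<epsilon>" for n \<epsilon>
  proof -
    have meas: "stays x j \<in> sets (M \<alpha> x)" for j by (rule past_sets[OF x' stays_past[OF x']])
    have [measurable]: "(\<lambda>\<omega>. \<Psi> (X \<alpha> x n \<omega>)) \<in> borel_measurable (M \<alpha> x)"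
      by (rule measurable_compose[OF measurable_X_states[OF x'] Psi_measurable])
    have "P.prob (stays x ((n - 1) div N)) \<le>
        P.prob {\<omega> \<in> stays x ((n - 1) div N). \<Psi> (X \<alpha> x n \<omega>) < \<epsilon>} + \<gamma>' / \<gamma> ^ (N - 1) * \<gamma> ^ n * \<Psi> x / \<epsilon>"
      by (intro prob_large_Psi x' meas \<epsilon> decay n mult_nonneg_nonneg[OF coeff(1)] Psi_nonneg)
    moreover have "P.prob {\<omega> \<in> stays x ((n - 1) div N). \<Psi> (X \<alpha> x n \<omega>) < \<epsilon>} \<le>
        P.prob {\<omega> \<in> space (M \<alpha> x). \<Psi> (X \<alpha> x n \<omega>) < \<epsilon>}"
      by (intro P.finite_measure_mono) (auto simp: stay_event_def)
    ultimately show ?thesis by (simp add: mult_ac)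
  qed
  show "let \<gamma> = rate \<Delta>\<^sub>3 \<Delta>\<^sub>4 \<alpha>;
            N = block_length \<Delta>\<^sub>3 \<Delta>\<^sub>4 \<alpha>;
            \<gamma>' = block_max \<Delta>\<^sub>3 \<Delta>\<^sub>4 \<alpha>;
            P = M \<alpha> x;
            \<theta> = X \<alpha> x;
            \<Omega> = stay_event P \<theta> U N
        in (\<forall>k. measure P (\<Omega> k) \<ge> 1 - \<Psi> x / \<zeta> * ((\<gamma> ^ N - \<gamma> ^ (N * (k + 1))) / (1 - \<gamma> ^ N))) \<and>
           measure P (\<Inter>k. \<Omega> k) \<ge> 1 - \<Psi> x / \<zeta> * (\<gamma> ^ N / (1 - \<gamma> ^ N)) \<and>
           (\<forall>n\<ge>1. (\<integral>\<^sup>+\<omega>. ennreal (\<Psi> (\<theta> n \<omega>) * indicator (\<Omega> ((n - 1) div N)) \<omega>) \<partial>P)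
                     \<le> ennreal (\<gamma>' / \<gamma> ^ (N - 1) * \<gamma> ^ n * \<Psi> x)) \<and>
           (\<forall>n\<ge>1. \<forall>\<epsilon>>0. measure P {\<omega>\<in>space P. \<Psi> (\<theta> n \<omega>) < \<epsilon>}
                     \<ge> measure P (\<Omega> ((n - 1) div N)) - \<Psi> x / \<epsilon> * \<gamma> ^ n * (\<gamma>' / \<gamma> ^ (N - 1)))"
    unfolding Let_def defs using exit exit_inf decay' small by blast
qed

end
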